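(* Let $f_1(\mathbf x)=\cdots=f_m(\mathbf x)=0$ be a polynomial system in $\mathbf x=(x_1,\ldots,x_m)$ whose polynomials are linear combinations of polynomials in a finite set $\mathcal A\subset\mathbb C[\mathbf x]$, where $\mathcal A$ contains a nonzero constant. Suppose that $\mathcal A$ can be split into $d$ sets $$\mathcal A=\bigcup_{i=1}^d\mathcal B_i$$ such that the polynomials from different sets $\mathcal B_i$ do not share variables with each other and each $\mathcal B_i$ contains a nonzero constant. Fix a monomial order on $\mathbb C[\mathbf x]$. Suppose that for each $i=1,\ldots,d$ the polynomials in $G_i:=\{s_ih\mid h\in\mathcal B_i\}$ form a Khovanskii basis of the subalgebra (of $\mathbb C[s_i,\mathbf x]$) that they generate. Then the polynomials in $G:=\{sh\mid h\in\mathcal A\}$ also form a Khovanskii basis for the subalgebra (of $\mathbb C[s,\mathbf x]$) that they generate.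
   Context: Here $s,s_1,\ldots,s_d$ are additional variables. The monomial order $\succ$ on $\mathbb C[\mathbf x]$ is extended to $\mathbb C[s,\mathbf x]$ (and likewise to $\mathbb C[s_i,\mathbf x]$) by $s^\alpha\mathbf x^a\succ s^\beta\mathbf x^b$ if $\alpha>\beta$, or $\alpha=\beta$ and $a\succ b$. $\mathrm{LT}$ denotes the leading term. For a subalgebra $S$ of such a polynomial ring, the initial algebra is $S_{\mathrm{in}}=\operatorname{span}_{\mathbb C}\{\mathrm{LT}(f)\mid f\in S\}$. A subset $G\subset S$ is a Khovanskii basis of $S$ if the leading monomials of the elements of $G$ generate $S_{\mathrm{in}}$ as an algebra. *)

theory Defs
  imports Complex_Main "HOL-Library.Poly_Mapping" "HOL-Library.Product_Plus" "HOL-Library.Cardinality"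
begin

text \<open>
  Complex polynomials are represented as the monoid algebra over a commutative monoid \<open>'e\<close> of
  exponents. For \<open>'e = ('v \<Rightarrow>\<^sub>0 nat)\<close> this is the polynomial ring in the variables \<open>'v\<close>. For
  \<open>'e = nat \<times> ('v \<Rightarrow>\<^sub>0 nat)\<close>, with componentwise addition, it is the polynomial ring with one
  additional variable \<open>s\<close>, whose name (\<open>s\<close> or \<open>s\<^sub>i\<close>) plays no role; the exponent of \<open>s ^ \<alpha> * x ^ a\<close> is the pair \<open>(\<alpha>, a)\<close>.
\<close>

type_synonym 'e cpoly = "'e \<Rightarrow>\<^sub>0 complex"

type_synonym 'v xpoly = "('v \<Rightarrow>\<^sub>0 nat) cpoly"

type_synonym 'v sxpoly = "(nat \<times> ('v \<Rightarrow>\<^sub>0 nat)) cpoly"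

definition const_poly :: "complex \<Rightarrow> 'e::comm_monoid_add cpoly"
  where "const_poly c = Poly_Mapping.single 0 c"

definition scale_poly :: "complex \<Rightarrow> 'e cpoly \<Rightarrow> 'e::comm_monoid_add cpoly"
  where "scale_poly c p = const_poly c * p"

global_interpretation cpoly: vector_space "scale_poly :: complex \<Rightarrow> 'e cpoly \<Rightarrow> 'e::comm_monoid_add cpoly"
  defines cpoly_subspace = cpoly.subspace
    and cpoly_span = cpoly.span
  by unfold_locales
    (simp_all add: scale_poly_def const_poly_def algebra_simps single_add mult_single
      flip: mult.assoc)

text \<open>Subalgebras contain the unit.\<close>

definition subalgebra :: "'e::comm_monoid_add cpoly set \<Rightarrow> bool"
  where "subalgebra S \<longleftrightarrow>
    cpoly_subspace S \<and> 1 \<in> S \<and> (\<forall>p\<in>S. \<forall>q\<in>S. p * q \<in> S)"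

definition generated_subalgebra :: "'e::comm_monoid_add cpoly set \<Rightarrow> 'e cpoly set"
  where "generated_subalgebra G = subalgebra hull G"

definition occurring_vars :: "'v xpoly \<Rightarrow> 'v set"
  where "occurring_vars p = (\<Union>a\<in>Poly_Mapping.keys p. Poly_Mapping.keys a)"

text \<open>In the following, \<open>gt a b\<close> means that the monomial with exponent \<open>a\<close> is strictly larger
  than the one with exponent \<open>b\<close>.\<close>

definition monomial_order :: "('e::comm_monoid_add \<Rightarrow> 'e \<Rightarrow> bool) \<Rightarrow> bool"
  where "monomial_order gt \<longleftrightarrow>
    irreflp gt \<and> transp gt \<and> totalp gt \<and>
    (\<forall>a b c. gt a b \<longrightarrow> gt (a + c) (b + c)) \<and>
    wfp (\<lambda>a b. gt b a)"

definition extend_order :: "('e \<Rightarrow> 'e \<Rightarrow> bool) \<Rightarrow> nat \<times> 'e \<Rightarrow> nat \<times> 'e \<Rightarrow> bool"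
  where "extend_order gt = (\<lambda>(\<alpha>, a) (\<beta>, b). \<alpha> > \<beta> \<or> (\<alpha> = \<beta> \<and> gt a b))"

text \<open>The leading exponent is meaningful only for \<open>p \<noteq> 0\<close>.\<close>

definition leading_exponent :: "('e \<Rightarrow> 'e \<Rightarrow> bool) \<Rightarrow> 'e cpoly \<Rightarrow> 'e"
  where "leading_exponent gt p =
    (THE a. a \<in> Poly_Mapping.keys p \<and> (\<forall>b\<in>Poly_Mapping.keys p. b \<noteq> a \<longrightarrow> gt a b))"

definition leading_monomial :: "('e \<Rightarrow> 'e \<Rightarrow> bool) \<Rightarrow> 'e cpoly \<Rightarrow> 'e cpoly"
  where "leading_monomial gt p = Poly_Mapping.single (leading_exponent gt p) 1"

definition leading_term :: "('e \<Rightarrow> 'e \<Rightarrow> bool) \<Rightarrow> 'e cpoly \<Rightarrow> 'e cpoly"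
  where "leading_term gt p =
    Poly_Mapping.single (leading_exponent gt p)
      (Poly_Mapping.lookup p (leading_exponent gt p))"

text \<open>The convention \<open>LT(0) = 0\<close> would give the same initial algebra and the same generated
  subalgebra as excluding \<open>0\<close>, which is done below.\<close>

definition initial_algebra ::
    "('e \<Rightarrow> 'e \<Rightarrow> bool) \<Rightarrow> 'e cpoly set \<Rightarrow> 'e::comm_monoid_add cpoly set"
  where "initial_algebra gt S = cpoly_span {leading_term gt f | f. f \<in> S \<and> f \<noteq> 0}"

definition khovanskii_basis ::
    "('e \<Rightarrow> 'e \<Rightarrow> bool) \<Rightarrow> 'e cpoly set \<Rightarrow> 'e::comm_monoid_add cpoly set \<Rightarrow> bool"
  where "khovanskii_basis gt G S \<longleftrightarrow>
    G \<subseteq> S \<and>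
    generated_subalgebra {leading_monomial gt g | g. g \<in> G \<and> g \<noteq> 0} = initial_algebra gt S"

definition s_var :: "'v sxpoly"
  where "s_var = Poly_Mapping.single (1, 0) 1"

text \<open>The inclusion of the polynomials in \<open>x\<close> into the polynomials in \<open>s, x\<close>.\<close>

definition embed_poly :: "'v xpoly \<Rightarrow> 'v sxpoly"
  where "embed_poly h =
    (\<Sum>a\<in>Poly_Mapping.keys h. Poly_Mapping.single (0, a) (Poly_Mapping.lookup h a))"

definition homogenized :: "'v xpoly set \<Rightarrow> 'v sxpoly set"
  where "homogenized \<B> = {s_var * embed_poly h | h. h \<in> \<B>}"

end

theory Submission
  imports Defs
begin

text \<open>
  A Khovanskii basis is a statement about leading exponents only: \<open>G\<close> is a Khovanskii basis of a
  subalgebra \<open>S\<close> that contains it iff every leading exponent of \<open>S\<close> is a sum of leading exponents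
  of \<open>G\<close> (\<open>khovanskii_basis_iff\<close>). It suffices to join two sets \<open>\<B>\<close> and \<open>\<C>\<close> of polynomials in
  separate variables, as the general case follows by induction on the number of sets.

  Let \<open>S\<close> and \<open>T\<close> be the algebras generated by the homogenizations of \<open>\<B>\<close> and \<open>\<C>\<close>. The algebra
  generated by both is spanned by the products of an element of \<open>S\<close> and one of \<open>T\<close>. The claim is
  that each of its leading exponents is a sum of one of \<open>S\<close> and one of \<open>T\<close>, even though leading
  terms may cancel in a sum of such products. The two algebras share only the variable \<open>s\<close>, and
  the constants in \<open>\<B>\<close> and \<open>\<C>\<close> ensure that \<open>s\<close> lies in both of them. Hence \<open>S\<close> is spanned by
  elements \<open>s ^ j * g a\<close>, with one \<open>g a\<close> for each exponent \<open>a\<close> of \<open>x\<close> that occurs in a leading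
  exponent of \<open>S\<close>, and \<open>T\<close> by similar elements \<open>s ^ j * h b\<close> (\<open>subalgebra_s_adapted_basis\<close>). So the
  products are spanned by \<open>s ^ n * g a * h b\<close>, whose leading exponents are pairwise distinct because
  \<open>a\<close> and \<open>b\<close> involve separate variables. Nothing can cancel among elements with distinct leading
  exponents, so these are all the leading exponents that occur
  (\<open>leading_exponents_product_subalgebra\<close>).
\<close>

section \<open>Spans and generated subalgebras\<close>

lemma scale_poly_mult_left: "scale_poly c p * q = scale_poly c (p * q)"
  by (simp add: scale_poly_def mult.assoc)

lemma scale_poly_mult_right: "p * scale_poly c q = scale_poly c (p * q)"
  by (simp add: scale_poly_def mult.left_commute)

lemma scale_poly_single: "scale_poly c (Poly_Mapping.single e b) = Poly_Mapping.single e (c * b)"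
  by (simp add: scale_poly_def const_poly_def mult_single)

lemma sum_monomials_eq:
  "(\<Sum>e\<in>Poly_Mapping.keys p. Poly_Mapping.single e (Poly_Mapping.lookup p e)) = p"
  by (rule poly_mapping_eqI) (auto simp: lookup_sum lookup_single when_def in_keys_iff)

lemma lookup_scale_poly: "Poly_Mapping.lookup (scale_poly c p) e = c * Poly_Mapping.lookup p e"
proof -
  have "scale_poly c p = (\<Sum>b\<in>Poly_Mapping.keys p.
      scale_poly c (Poly_Mapping.single b (Poly_Mapping.lookup p b)))"
    by (subst sum_monomials_eq[of p, symmetric]) (rule cpoly.scale_sum_right)
  also have "Poly_Mapping.lookup \<dots> e = c * Poly_Mapping.lookup p e"
    by (auto simp: scale_poly_single lookup_sum lookup_single when_def in_keys_iff)
  finally show ?thesis .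
qed

lemma keys_scale_poly_subset: "Poly_Mapping.keys (scale_poly c p) \<subseteq> Poly_Mapping.keys p"
  by (auto simp: in_keys_iff lookup_scale_poly)

lemma mult_in_span_of_products:
  assumes "p \<in> cpoly_span X" and "q \<in> cpoly_span Y"
  shows "p * q \<in> cpoly_span {x * y | x y. x \<in> X \<and> y \<in> Y}"
proof -
  let ?T = "cpoly_span {x * y | x y. x \<in> X \<and> y \<in> Y}"
  have left: "x * q \<in> ?T" if "x \<in> X" for x
    using assms(2)
  proof (induction rule: cpoly.span_induct_alt)
    case base
    show ?case by (simp add: cpoly.span_zero)
  next
    case (step c y z)
    have "x * y \<in> ?T"
      using that step.hyps by (blast intro: cpoly.span_base)
    thus ?case
      using step.IH
      by (simp add: distrib_left scale_poly_mult_right cpoly.span_add cpoly.span_scale)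
  qed
  show ?thesis
    using assms(1)
  proof (induction rule: cpoly.span_induct_alt)
    case base
    show ?case by (simp add: cpoly.span_zero)
  next
    case (step c x z)
    thus ?case
      using left[of x]
      by (simp add: distrib_right scale_poly_mult_left cpoly.span_add cpoly.span_scale)
  qed
qed

lemma subalgebra_generated: "subalgebra (generated_subalgebra G)"
  unfolding generated_subalgebra_def
  by (rule hull_in) (auto simp: subalgebra_def intro: cpoly.subspace_Inter)

lemma generated_subalgebra_minimal:
  "G \<subseteq> S \<Longrightarrow> subalgebra S \<Longrightarrow> generated_subalgebra G \<subseteq> S"
  unfolding generated_subalgebra_def by (rule hull_minimal)

lemma generated_subalgebra_superset: "G \<subseteq> generated_subalgebra G"
  unfolding generated_subalgebra_def by (rule hull_subset)

lemma subalgebra_power: "subalgebra S \<Longrightarrow> p \<in> S \<Longrightarrow> p ^ n \<in> S"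
  by (induction n) (auto simp: subalgebra_def)

lemma subalgebra_span_products:
  assumes "subalgebra S" and "subalgebra T"
  shows "subalgebra (cpoly_span {p * q | p q. p \<in> S \<and> q \<in> T})"
proof -
  let ?X = "{p * q | p q. p \<in> S \<and> q \<in> T}"
  have one: "1 \<in> ?X"
    using assms unfolding subalgebra_def by (metis (mono_tags, lifting) mem_Collect_eq mult_1)
  have "x * y \<in> ?X" if "x \<in> ?X" "y \<in> ?X" for x y
  proof -
    from that obtain p q p' q' where "x = p * q" "y = p' * q'" "p \<in> S" "p' \<in> S" "q \<in> T" "q' \<in> T"
      by blast
    moreover from this have "x * y = (p * p') * (q * q')"
      by (simp add: ac_simps)
    ultimately show ?thesis
      using assms unfolding subalgebra_def by blast
  qed
  hence "{x * y | x y. x \<in> ?X \<and> y \<in> ?X} \<subseteq> ?X"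
    by blast
  hence "p * q \<in> cpoly_span ?X" if "p \<in> cpoly_span ?X" "q \<in> cpoly_span ?X" for p q
    using mult_in_span_of_products[OF that] cpoly.span_mono by blast
  thus ?thesis
    unfolding subalgebra_def using cpoly.span_base[OF one] cpoly.subspace_span by blast
qed

section \<open>Algebras spanned by monomials\<close>

lemma subspace_keys_subset: "cpoly_subspace {p. Poly_Mapping.keys p \<subseteq> E}"
proof -
  have "Poly_Mapping.keys (p + q) \<subseteq> E"
    if "Poly_Mapping.keys p \<subseteq> E" "Poly_Mapping.keys q \<subseteq> E" for p q :: "'a cpoly"
    using that Poly_Mapping.keys_add[of p q] by blast
  moreover have "Poly_Mapping.keys (scale_poly c p) \<subseteq> E" if "Poly_Mapping.keys p \<subseteq> E" for c p
    using that keys_scale_poly_subset[of c p] by blast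
  ultimately show ?thesis
    by (simp add: cpoly.subspace_def)
qed

lemma in_subspace_if_monomials:
  assumes "cpoly_subspace S" and "\<And>e. e \<in> Poly_Mapping.keys p \<Longrightarrow> Poly_Mapping.single e 1 \<in> S"
  shows "p \<in> S"
proof -
  have "p = (\<Sum>e\<in>Poly_Mapping.keys p. Poly_Mapping.single e (Poly_Mapping.lookup p e))"
    by (simp add: sum_monomials_eq)
  also have "\<dots> = (\<Sum>e\<in>Poly_Mapping.keys p.
      scale_poly (Poly_Mapping.lookup p e) (Poly_Mapping.single e 1))"
    by (simp add: scale_poly_single)
  also have "\<dots> \<in> S"
    using assms by (intro cpoly.subspace_sum cpoly.subspace_scale) auto
  finally show ?thesis .
qed

inductive_set monoid_closure :: "'e::comm_monoid_add set \<Rightarrow> 'e set" for E where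
  zero: "0 \<in> monoid_closure E"
| add: "a \<in> E \<Longrightarrow> b \<in> monoid_closure E \<Longrightarrow> a + b \<in> monoid_closure E"

lemma monoid_closure_base: "a \<in> E \<Longrightarrow> a \<in> monoid_closure E"
  using monoid_closure.add[OF _ monoid_closure.zero] by fastforce

lemma monoid_closure_add:
  "a \<in> monoid_closure E \<Longrightarrow> b \<in> monoid_closure E \<Longrightarrow> a + b \<in> monoid_closure E"
  by (induction rule: monoid_closure.induct) (auto simp: add.assoc intro: monoid_closure.intros)

lemma monoid_closure_mono:
  assumes "E \<subseteq> F" shows "monoid_closure E \<subseteq> monoid_closure F"
proof
  fix a assume "a \<in> monoid_closure E"
  thus "a \<in> monoid_closure F"
    by induction (use assms in \<open>auto intro: monoid_closure.intros\<close>)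
qed

text \<open>The polynomials with exponents in a submonoid form an algebra, and each of its monomials is a
  product of generators.\<close>

lemma generated_subalgebra_monomials:
  "generated_subalgebra {Poly_Mapping.single e 1 | e. e \<in> E} =
     {p. Poly_Mapping.keys p \<subseteq> monoid_closure E}" (is "?S = ?T")
proof
  have "p * q \<in> ?T" if "p \<in> ?T" "q \<in> ?T" for p q
    using that keys_mult[of p q] monoid_closure_add by fastforce
  moreover have "1 \<in> ?T"
    by (auto simp flip: single_one simp: monoid_closure.zero)
  ultimately have "subalgebra ?T"
    unfolding subalgebra_def using subspace_keys_subset by blast
  thus "?S \<subseteq> ?T"
    by (rule generated_subalgebra_minimal[rotated]) (auto simp: monoid_closure_base)
next
  have S: "subalgebra ?S"
    by (rule subalgebra_generated)
  have "Poly_Mapping.single e 1 \<in> ?S" if "e \<in> monoid_closure E" for e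
    using that
  proof induction
    case zero
    thus ?case using S by (simp add: subalgebra_def)
  next
    case (add a b)
    have "Poly_Mapping.single a 1 \<in> ?S"
      by (rule subsetD[OF generated_subalgebra_superset]) (use add.hyps(1) in blast)
    hence "Poly_Mapping.single a 1 * Poly_Mapping.single b 1 \<in> ?S"
      using S add.IH unfolding subalgebra_def by blast
    thus ?case by (simp add: mult_single)
  qed
  thus "?T \<subseteq> ?S"
    using S in_subspace_if_monomials unfolding subalgebra_def by blast
qed

section \<open>Leading exponents\<close>

text \<open>The property by which \<^const>\<open>leading_exponent\<close> is selected, stated as a relation so that it can
  be proved for a candidate exponent before uniqueness is invoked.\<close>

definition has_leading_exponent ::
    "('e \<Rightarrow> 'e \<Rightarrow> bool) \<Rightarrow> 'e cpoly \<Rightarrow> 'e \<Rightarrow> bool"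
  where "has_leading_exponent gt p a \<longleftrightarrow>
    a \<in> Poly_Mapping.keys p \<and> (\<forall>b\<in>Poly_Mapping.keys p. b \<noteq> a \<longrightarrow> gt a b)"

definition leading_exponents ::
    "('e \<Rightarrow> 'e \<Rightarrow> bool) \<Rightarrow> 'e cpoly set \<Rightarrow> 'e set"
  where "leading_exponents gt S = {leading_exponent gt f | f. f \<in> S \<and> f \<noteq> 0}"

lemma leading_exponentsI:
  "f \<in> S \<Longrightarrow> f \<noteq> 0 \<Longrightarrow> leading_exponent gt f = e \<Longrightarrow> e \<in> leading_exponents gt S"
  by (auto simp: leading_exponents_def)

lemma leading_exponents_mono: "S \<subseteq> T \<Longrightarrow> leading_exponents gt S \<subseteq> leading_exponents gt T"
  by (auto simp: leading_exponents_def)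

locale monomial_ordering =
  fixes gt :: "'e::comm_monoid_add \<Rightarrow> 'e \<Rightarrow> bool"
  assumes monomial_order: "monomial_order gt"
begin

lemma gt_irrefl: "\<not> gt a a"
  using monomial_order unfolding monomial_order_def irreflp_def by blast

lemma gt_trans: "gt a b \<Longrightarrow> gt b c \<Longrightarrow> gt a c"
  using monomial_order unfolding monomial_order_def transp_def by blast

lemma gt_total: "a \<noteq> b \<Longrightarrow> gt a b \<or> gt b a"
  using monomial_order unfolding monomial_order_def totalp_on_def by blast

lemma gt_add_right: "gt a b \<Longrightarrow> gt (a + c) (b + c)"
  using monomial_order unfolding monomial_order_def by blast

lemma gt_add_left: "gt a b \<Longrightarrow> gt (c + a) (c + b)"
  using gt_add_right[of a b c] by (simp add: add.commute)

lemma wf_gt: "wfp (\<lambda>a b. gt b a)"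
  using monomial_order unfolding monomial_order_def by blast

lemma finite_has_max:
  assumes "finite A" and "A \<noteq> {}"
  obtains a where "a \<in> A" and "\<And>b. b \<in> A \<Longrightarrow> b \<noteq> a \<Longrightarrow> gt a b"
proof -
  have "\<exists>a\<in>A. \<forall>b\<in>A. b \<noteq> a \<longrightarrow> gt a b"
    using assms
  proof (induction rule: finite_ne_induct)
    case (singleton x)
    show ?case by simp
  next
    case (insert x F)
    then obtain a where a: "a \<in> F" "\<forall>b\<in>F. b \<noteq> a \<longrightarrow> gt a b"
      by blast
    with insert.hyps consider "gt a x" | "gt x a"
      using gt_total by metis
    thus ?case
    proof cases
      case 1
      thus ?thesis using a by blast
    next
      case 2
      hence "\<forall>b\<in>F. gt x b"
        using a gt_trans by metis
      thus ?thesis by blast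
    qed
  qed
  thus ?thesis using that by blast
qed

lemma leading_exponent_eqI: "has_leading_exponent gt p a \<Longrightarrow> leading_exponent gt p = a"
  unfolding leading_exponent_def has_leading_exponent_def
  by (rule the_equality) (blast, metis gt_irrefl gt_trans)

lemma has_leading_exponent:
  assumes "p \<noteq> 0"
  shows "has_leading_exponent gt p (leading_exponent gt p)"
proof -
  obtain a where "has_leading_exponent gt p a"
    using finite_has_max[of "Poly_Mapping.keys p"] assms
    by (metis finite_keys has_leading_exponent_def keys_eq_empty)
  thus ?thesis
    by (simp add: leading_exponent_eqI)
qed

lemma leading_exponent_in_keys: "p \<noteq> 0 \<Longrightarrow> leading_exponent gt p \<in> Poly_Mapping.keys p"
  using has_leading_exponent unfolding has_leading_exponent_def by blast

lemma gt_leading_exponent: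
  "b \<in> Poly_Mapping.keys p \<Longrightarrow> b \<noteq> leading_exponent gt p \<Longrightarrow> gt (leading_exponent gt p) b"
  using has_leading_exponent[of p] unfolding has_leading_exponent_def by fastforce

lemma leading_exponent_single:
  "c \<noteq> 0 \<Longrightarrow> leading_exponent gt (Poly_Mapping.single a c) = a"
  by (rule leading_exponent_eqI) (simp add: has_leading_exponent_def)

text \<open>Both factors split off their leading term. The product of these two terms cannot be
  cancelled, because all the other exponents that arise are strictly smaller.\<close>

lemma has_leading_exponent_mult:
  assumes "p \<noteq> 0" and "q \<noteq> 0"
  shows "has_leading_exponent gt (p * q) (leading_exponent gt p + leading_exponent gt q)"
proof -
  define a where "a = leading_exponent gt p"
  define b where "b = leading_exponent gt q"
  define c where "c = Poly_Mapping.lookup p a"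
  define d where "d = Poly_Mapping.lookup q b"
  define p' where "p' = p - Poly_Mapping.single a c"
  define q' where "q' = q - Poly_Mapping.single b d"
  have cd: "c \<noteq> 0" "d \<noteq> 0"
    using assms leading_exponent_in_keys unfolding a_def b_def c_def d_def
    by (simp_all add: in_keys_iff)
  have p': "gt a e" if "e \<in> Poly_Mapping.keys p'" for e
    using that gt_leading_exponent[of e p] unfolding p'_def a_def[symmetric]
    by (auto simp: in_keys_iff lookup_minus lookup_single when_def c_def split: if_splits)
  have q': "gt b e" if "e \<in> Poly_Mapping.keys q'" for e
    using that gt_leading_exponent[of e q] unfolding q'_def b_def[symmetric]
    by (auto simp: in_keys_iff lookup_minus lookup_single when_def d_def split: if_splits)
  define r where "r = Poly_Mapping.single a c * q' + p' * q"
  have pq: "p * q = Poly_Mapping.single (a + b) (c * d) + r"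
    by (simp add: r_def p'_def q'_def algebra_simps mult_single)
  have r: "gt (a + b) e" if "e \<in> Poly_Mapping.keys r" for e
  proof -
    from that have "e \<in> Poly_Mapping.keys (Poly_Mapping.single a c * q')
        \<or> e \<in> Poly_Mapping.keys (p' * q)"
      unfolding r_def using Poly_Mapping.keys_add by fastforce
    thus ?thesis
    proof
      assume "e \<in> Poly_Mapping.keys (Poly_Mapping.single a c * q')"
      then obtain e' where "e' \<in> Poly_Mapping.keys q'" "e = a + e'"
        using keys_mult[of "Poly_Mapping.single a c" q'] cd by auto
      thus ?thesis
        using q'[of e'] by (simp add: gt_add_left)
    next
      assume "e \<in> Poly_Mapping.keys (p' * q)"
      then obtain e1 e2 where e: "e1 \<in> Poly_Mapping.keys p'" "e2 \<in> Poly_Mapping.keys q"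
        "e = e1 + e2"
        using keys_mult[of p' q] by auto
      have "gt (a + e2) (e1 + e2)"
        using p'[OF e(1)] by (rule gt_add_right)
      moreover have "e2 = b \<or> gt (a + b) (a + e2)"
        using gt_leading_exponent[OF e(2)] gt_add_left unfolding b_def by metis
      ultimately show ?thesis
        using e(3) gt_trans by metis
    qed
  qed
  hence "Poly_Mapping.lookup r (a + b) = 0"
    using gt_irrefl in_keys_iff by metis
  hence "a + b \<in> Poly_Mapping.keys (p * q)"
    using cd by (simp add: in_keys_iff pq lookup_add)
  moreover have "gt (a + b) e" if "e \<in> Poly_Mapping.keys (p * q)" "e \<noteq> a + b" for e
    using that r unfolding pq
    by (auto simp: in_keys_iff lookup_add lookup_single when_def)
  ultimately show ?thesis
    unfolding has_leading_exponent_def a_def b_def by blast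
qed

lemma mult_nonzero:
  fixes p q :: "'e cpoly"
  shows "p \<noteq> 0 \<Longrightarrow> q \<noteq> 0 \<Longrightarrow> p * q \<noteq> 0"
  using has_leading_exponent_mult unfolding has_leading_exponent_def by fastforce

lemma leading_exponent_mult:
  "p \<noteq> 0 \<Longrightarrow> q \<noteq> 0 \<Longrightarrow>
     leading_exponent gt (p * q) = leading_exponent gt p + leading_exponent gt q"
  by (rule leading_exponent_eqI) (rule has_leading_exponent_mult)

lemma monoid_closure_leading_exponents_subset:
  assumes S: "subalgebra S" and "G \<subseteq> S"
  shows "monoid_closure (leading_exponents gt G) \<subseteq> leading_exponents gt S"
proof
  fix e assume "e \<in> monoid_closure (leading_exponents gt G)"
  thus "e \<in> leading_exponents gt S"
  proof induction
    case zero
    have "leading_exponent gt 1 = 0"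
      by (simp flip: single_one add: leading_exponent_single)
    thus ?case
      using S by (auto simp: subalgebra_def intro: leading_exponentsI[where f = 1])
  next
    case (add a b)
    then obtain p q where "p \<in> G" "p \<noteq> 0" "a = leading_exponent gt p"
      "q \<in> S" "q \<noteq> 0" "b = leading_exponent gt q"
      unfolding leading_exponents_def by blast
    thus ?case
      using assms unfolding subalgebra_def
      by (intro leading_exponentsI[where f = "p * q"])
        (auto simp: leading_exponent_mult mult_nonzero)
  qed
qed

lemma initial_algebra_eq:
  "initial_algebra gt S = {p. Poly_Mapping.keys p \<subseteq> leading_exponents gt S}" (is "_ = ?T")
proof
  show "initial_algebra gt S \<subseteq> ?T"
    unfolding initial_algebra_def
    by (rule cpoly.span_minimal[OF _ subspace_keys_subset])
      (auto simp: leading_term_def leading_exponents_def split: if_splits)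
next
  have "Poly_Mapping.single e 1 \<in> initial_algebra gt S" if "e \<in> leading_exponents gt S" for e
  proof -
    from that obtain f where f: "f \<in> S" "f \<noteq> 0" "e = leading_exponent gt f"
      unfolding leading_exponents_def by blast
    define c where "c = Poly_Mapping.lookup f e"
    have "c \<noteq> 0"
      using leading_exponent_in_keys[of f] f by (simp add: c_def in_keys_iff)
    hence "Poly_Mapping.single e 1 = scale_poly (inverse c) (leading_term gt f)"
      unfolding leading_term_def f(3)[symmetric] c_def[symmetric] by (simp add: scale_poly_single)
    moreover have "leading_term gt f \<in> initial_algebra gt S"
      unfolding initial_algebra_def using f by (blast intro: cpoly.span_base)
    ultimately show ?thesis
      unfolding initial_algebra_def by (simp add: cpoly.span_scale)
  qed
  thus "?T \<subseteq> initial_algebra gt S"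
    using in_subspace_if_monomials[OF cpoly.subspace_span] unfolding initial_algebra_def by blast
qed

text \<open>The algebra generated by leading monomials and the initial algebra are both spanned by
  monomials, so comparing them means comparing sets of exponents. One of the two inclusions
  holds for any subset of a subalgebra, because the leading exponent is additive.\<close>

lemma khovanskii_basis_iff:
  assumes "G \<subseteq> S" and "subalgebra S"
  shows "khovanskii_basis gt G S \<longleftrightarrow>
    leading_exponents gt S \<subseteq> monoid_closure (leading_exponents gt G)"
proof -
  have *: "{leading_monomial gt g | g. g \<in> G \<and> g \<noteq> 0} =
      {Poly_Mapping.single e 1 | e. e \<in> leading_exponents gt G}"
    unfolding leading_monomial_def leading_exponents_def by blast
  have **: "{p::'e cpoly. Poly_Mapping.keys p \<subseteq> E} = {p. Poly_Mapping.keys p \<subseteq> F} \<longleftrightarrow> E = F" for E F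
  proof
    assume eq: "{p::'e cpoly. Poly_Mapping.keys p \<subseteq> E} = {p. Poly_Mapping.keys p \<subseteq> F}"
    have "e \<in> E \<longleftrightarrow> e \<in> F" for e
      using eq[THEN eqset_imp_iff, of "Poly_Mapping.single e 1"] by simp
    thus "E = F" by blast
  qed simp
  show ?thesis
    unfolding khovanskii_basis_def * generated_subalgebra_monomials initial_algebra_eq **
    using assms monoid_closure_leading_exponents_subset[OF assms(2,1)] by blast
qed

text \<open>Subtracting a multiple of the element of \<open>P\<close> with the same leading exponent gives \<open>0\<close> or makes
  the leading exponent smaller, which cannot go on forever in a well-order.\<close>

lemma subset_span_if_leading_exponents:
  assumes S: "cpoly_subspace S" and P: "P \<subseteq> S"
    and le: "leading_exponents gt S \<subseteq> leading_exponents gt P"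
  shows "S \<subseteq> cpoly_span P"
proof -
  have "\<forall>f\<in>S. f \<noteq> 0 \<longrightarrow> leading_exponent gt f = e \<longrightarrow> f \<in> cpoly_span P" for e
  proof (induction e rule: wfp_induct_rule[OF wf_gt])
    case (1 e)
    show ?case
    proof (intro ballI impI)
      fix f assume f: "f \<in> S" "f \<noteq> 0" "leading_exponent gt f = e"
      hence "e \<in> leading_exponents gt P"
        using subsetD[OF le leading_exponentsI] by simp
      then obtain p where p: "p \<in> P" "p \<noteq> 0" "leading_exponent gt p = e"
        unfolding leading_exponents_def by blast
      define c where "c = Poly_Mapping.lookup f e / Poly_Mapping.lookup p e"
      define r where "r = f - scale_poly c p"
      have "Poly_Mapping.lookup p e \<noteq> 0"
        using leading_exponent_in_keys[OF p(2)] p by (simp add: in_keys_iff)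
      hence r_e: "Poly_Mapping.lookup r e = 0"
        by (simp add: r_def c_def lookup_minus lookup_scale_poly)
      have "r \<in> S"
        unfolding r_def using S P p f
        by (intro cpoly.subspace_diff cpoly.subspace_scale) auto
      have "r \<in> cpoly_span P"
      proof (cases "r = 0")
        case True
        thus ?thesis by (simp add: cpoly.span_zero)
      next
        case False
        define e' where "e' = leading_exponent gt r"
        have e': "e' \<in> Poly_Mapping.keys r"
          unfolding e'_def using False by (rule leading_exponent_in_keys)
        hence "e' \<noteq> e"
          using r_e by (auto simp: in_keys_iff)
        moreover have "e' \<in> Poly_Mapping.keys f \<or> e' \<in> Poly_Mapping.keys p"
          using e' by (auto simp: in_keys_iff r_def lookup_minus lookup_scale_poly)
        ultimately have "gt e e'"
          using gt_leading_exponent f p by metis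
        thus ?thesis
          using 1[of e'] False \<open>r \<in> S\<close> e'_def by simp
      qed
      moreover have "scale_poly c p \<in> cpoly_span P"
        using p by (simp add: cpoly.span_base cpoly.span_scale)
      ultimately have "r + scale_poly c p \<in> cpoly_span P"
        by (rule cpoly.span_add)
      thus "f \<in> cpoly_span P"
        by (simp add: r_def)
    qed
  qed
  thus ?thesis
    using cpoly.span_zero[of P] by (metis subsetI)
qed

text \<open>Among the elements of \<open>P\<close> that occur in a linear combination, one has the largest leading
  exponent, and as the leading exponents are distinct, nothing cancels it.\<close>

lemma leading_exponent_in_span:
  assumes nz: "0 \<notin> P" and inj: "inj_on (leading_exponent gt) P"
    and f: "f \<in> cpoly_span P" "f \<noteq> 0"
  shows "leading_exponent gt f \<in> leading_exponents gt P"
proof -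
  obtain t u where t: "finite t" "t \<subseteq> P" and "f = (\<Sum>p\<in>t. scale_poly (u p) p)"
    using f(1) unfolding cpoly.span_explicit by blast
  (* Only the elements with a nonzero coefficient can contribute the leading term. *)
  define t' where "t' = {p\<in>t. u p \<noteq> 0}"
  have f_eq: "f = (\<Sum>p\<in>t'. scale_poly (u p) p)"
    unfolding \<open>f = _\<close> t'_def using t by (intro sum.mono_neutral_right) auto
  have t': "finite t'" "t' \<subseteq> P" "\<And>p. p \<in> t' \<Longrightarrow> u p \<noteq> 0"
    using t by (auto simp: t'_def)
  have "t' \<noteq> {}"
    using f_eq f(2) by auto
  then obtain e where "e \<in> leading_exponent gt ` t'"
    and max: "\<And>b. b \<in> leading_exponent gt ` t' \<Longrightarrow> b \<noteq> e \<Longrightarrow> gt e b"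
    using finite_has_max[of "leading_exponent gt ` t'"] t' by blast
  then obtain p where p: "p \<in> t'" "e = leading_exponent gt p"
    by blast
  have nz': "q \<noteq> 0" if "q \<in> t'" for q
    using that nz t' by blast
  have less: "gt e (leading_exponent gt q)" if "q \<in> t'" "q \<noteq> p" for q
    using max[of "leading_exponent gt q"] inj that p t' unfolding inj_on_def by blast
  have keys_le: "b = e \<or> gt e b" if "b \<in> Poly_Mapping.keys q" "q \<in> t'" for b q
    using gt_leading_exponent[OF that(1)] less[OF that(2)] gt_trans p by metis
  have other: "Poly_Mapping.lookup q e = 0" if "q \<in> t'" "q \<noteq> p" for q
  proof (rule ccontr)
    assume "\<not> ?thesis"
    hence "e = leading_exponent gt q \<or> gt (leading_exponent gt q) e"
      using gt_leading_exponent in_keys_iff by metis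
    thus False
      using less[OF that] gt_trans gt_irrefl by metis
  qed
  have lookup_f: "Poly_Mapping.lookup f b = (\<Sum>q\<in>t'. u q * Poly_Mapping.lookup q b)" for b
    unfolding f_eq by (simp add: lookup_sum lookup_scale_poly)
  have "Poly_Mapping.lookup f e = u p * Poly_Mapping.lookup p e"
    unfolding lookup_f using t'(1) p other
    by (subst sum.remove[of _ p]) (auto intro: sum.neutral)
  moreover have "Poly_Mapping.lookup p e \<noteq> 0"
    using leading_exponent_in_keys[OF nz'] p by (simp add: in_keys_iff)
  ultimately have "e \<in> Poly_Mapping.keys f"
    using t' p by (simp add: in_keys_iff)
  moreover have "gt e b" if "b \<in> Poly_Mapping.keys f" "b \<noteq> e" for b
  proof -
    have "(\<Sum>q\<in>t'. u q * Poly_Mapping.lookup q b) \<noteq> 0"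
      using that(1) by (simp add: in_keys_iff lookup_f)
    then obtain q where "q \<in> t'" "u q * Poly_Mapping.lookup q b \<noteq> 0"
      by (rule sum.not_neutral_contains_not_neutral)
    hence "b \<in> Poly_Mapping.keys q"
      by (auto simp: in_keys_iff)
    thus ?thesis
      using keys_le \<open>q \<in> t'\<close> that(2) by blast
  qed
  ultimately have "leading_exponent gt f = e"
    by (intro leading_exponent_eqI) (auto simp: has_leading_exponent_def)
  thus ?thesis
    using p t'(2) nz' by (intro leading_exponentsI[where f = p]) auto
qed

end

section \<open>Subalgebras that contain the additional variable\<close>

lemma monomial_order_extend:
  assumes "monomial_order gt"
  shows "monomial_order (extend_order gt)"
proof -
  interpret monomial_ordering gt
    using assms by unfold_locales
  have eq: "(\<lambda>x y. extend_order gt y x) =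
      (\<lambda>x y. (x, y) \<in> less_than <*lex*> {(a, b). gt b a})"
    by (auto simp: extend_order_def fun_eq_iff)
  have "wf {(a, b). gt b a}"
    using wf_gt by (simp add: wfp_def)
  hence "wfp (\<lambda>x y. extend_order gt y x)"
    unfolding eq by (simp add: wfp_def wf_lex_prod)
  moreover have "irreflp (extend_order gt)"
    by (auto simp: irreflp_def extend_order_def gt_irrefl)
  moreover have "transp (extend_order gt)"
    by (auto simp: transp_def extend_order_def intro: gt_trans)
  moreover have "totalp (extend_order gt)"
    using gt_total by (fastforce simp: totalp_on_def extend_order_def)
  ultimately show ?thesis
    unfolding monomial_order_def by (auto simp: extend_order_def gt_add_right)
qed

lemma s_var_power: "s_var ^ n = Poly_Mapping.single (n, 0) 1"
  by (induction n) (simp_all add: s_var_def mult_single flip: single_one zero_prod_def)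

lemma s_var_power_nonzero: "s_var ^ n \<noteq> 0"
  by (simp add: s_var_power flip: keys_eq_empty)

text \<open>The elements \<open>g a\<close> are chosen with leading exponent \<open>(k, a)\<close> such that \<open>k\<close> is smallest
  possible. The leading exponents of their multiples by powers of \<open>s\<close> are then exactly those of
  \<open>S\<close>, because the exponents of \<open>s\<close> above \<open>a\<close> form an upward closed set.\<close>

lemma subalgebra_s_adapted_basis:
  fixes S :: "'v sxpoly set"
  assumes order: "monomial_order ord" and S: "subalgebra S" and s: "s_var \<in> S"
  obtains A g where
    "\<forall>a\<in>A. g a \<in> S \<and> g a \<noteq> 0 \<and> snd (leading_exponent ord (g a)) = a"
    and "S \<subseteq> cpoly_span {s_var ^ j * g a | j a. a \<in> A}"
proof -
  interpret monomial_ordering ord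
    using order by unfold_locales
  define A where "A = snd ` leading_exponents ord S"
  define k where "k a = (LEAST k. (k, a) \<in> leading_exponents ord S)" for a
  have k: "(k a, a) \<in> leading_exponents ord S" if "a \<in> A" for a
    using that unfolding k_def A_def by (auto intro: LeastI)
  define g where "g a = (SOME g. g \<in> S \<and> g \<noteq> 0 \<and> leading_exponent ord g = (k a, a))" for a
  have g: "g a \<in> S \<and> g a \<noteq> 0 \<and> leading_exponent ord (g a) = (k a, a)" if "a \<in> A" for a
    unfolding g_def using k[OF that] by - (rule someI_ex, auto simp: leading_exponents_def)
  define P where "P = {s_var ^ j * g a | j a. a \<in> A}"
  have "P \<subseteq> S"
    unfolding P_def using S g subalgebra_power[OF S s] by (auto simp: subalgebra_def)
  moreover have "leading_exponents ord S \<subseteq> leading_exponents ord P"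
  proof
    fix e assume e: "e \<in> leading_exponents ord S"
    define a where "a = snd e"
    have a: "a \<in> A"
      using e by (simp add: a_def A_def)
    have "k a \<le> fst e"
      unfolding k_def a_def using e by (intro Least_le) simp
    define j where "j = fst e - k a"
    have "leading_exponent ord (s_var ^ j) = (j, 0)"
      by (simp add: s_var_power leading_exponent_single)
    hence "leading_exponent ord (s_var ^ j * g a) = (j, 0) + (k a, a)"
      using g[OF a] by (simp add: leading_exponent_mult s_var_power_nonzero)
    moreover have "(j, 0) + (k a, a) = e"
      using \<open>k a \<le> fst e\<close> by (simp add: j_def a_def)
    moreover have "s_var ^ j * g a \<noteq> 0"
      using g[OF a] by (simp add: mult_nonzero s_var_power_nonzero)
    moreover have "s_var ^ j * g a \<in> P"
      using a by (auto simp: P_def)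
    ultimately show "e \<in> leading_exponents ord P"
      by (auto intro: leading_exponentsI)
  qed
  ultimately have "S \<subseteq> cpoly_span P"
    using S by (intro subset_span_if_leading_exponents) (auto simp: subalgebra_def)
  thus ?thesis
    using g unfolding P_def by (intro that[of A g]) simp_all
qed

definition vars_in :: "'v set \<Rightarrow> 'v sxpoly set"
  where "vars_in V = {p. Poly_Mapping.keys p \<subseteq> {(k, a). Poly_Mapping.keys a \<subseteq> V}}"

lemma subalgebra_vars_in: "subalgebra (vars_in V)"
proof -
  have "p * q \<in> vars_in V" if "p \<in> vars_in V" "q \<in> vars_in V" for p q
  proof -
    have "Poly_Mapping.keys a \<subseteq> V" if e: "(k, a) \<in> Poly_Mapping.keys (p * q)" for k a
    proof -
      obtain x y where "x \<in> Poly_Mapping.keys p" "y \<in> Poly_Mapping.keys q" "(k, a) = x + y"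
        using e keys_mult[of p q] by blast
      moreover from this have "a = snd x + snd y"
        by (metis snd_conv snd_add)
      ultimately show ?thesis
        using \<open>p \<in> vars_in V\<close> \<open>q \<in> vars_in V\<close> Poly_Mapping.keys_add[of "snd x" "snd y"]
        unfolding vars_in_def by fastforce
    qed
    thus ?thesis by (auto simp: vars_in_def)
  qed
  moreover have "1 \<in> vars_in V"
    by (auto simp: vars_in_def zero_prod_def simp flip: single_one)
  moreover have "cpoly_subspace (vars_in V)"
    unfolding vars_in_def by (rule subspace_keys_subset)
  ultimately show ?thesis
    by (simp add: subalgebra_def)
qed

lemma add_disjoint_keys_cancel:
  fixes a a' b b' :: "'v \<Rightarrow>\<^sub>0 nat"
  assumes "Poly_Mapping.keys a \<subseteq> V" "Poly_Mapping.keys a' \<subseteq> V"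
    and "Poly_Mapping.keys b \<subseteq> W" "Poly_Mapping.keys b' \<subseteq> W"
    and "V \<inter> W = {}" and eq: "a + b = a' + b'"
  shows "a = a'" and "b = b'"
proof -
  have "Poly_Mapping.lookup a v = Poly_Mapping.lookup a' v" for v
  proof (cases "v \<in> V")
    case True
    hence "Poly_Mapping.lookup b v = 0" "Poly_Mapping.lookup b' v = 0"
      using assms by (auto simp: in_keys_iff)
    thus ?thesis
      using arg_cong[OF eq, of "\<lambda>x. Poly_Mapping.lookup x v"] by (simp add: lookup_add)
  next
    case False
    hence "Poly_Mapping.lookup a v = 0" "Poly_Mapping.lookup a' v = 0"
      using assms by (auto simp: in_keys_iff)
    thus ?thesis by simp
  qed
  thus "a = a'" by (simp add: poly_mapping_eqI)
  with eq show "b = b'" by simp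
qed

text \<open>The products \<open>s ^ n * g a * h b\<close> of the adapted bases span all products of elements of the
  two algebras.
  Their leading exponents are distinct: as the variables are separated, \<open>a + b\<close>
  determines \<open>a\<close> and \<open>b\<close>, after which the exponent of \<open>s\<close> determines \<open>n\<close>.
  The powers of \<open>s\<close> in the two factors enter the leading
  exponent only through their sum, so they have to be merged into the single factor \<open>s ^ n\<close>.\<close>

lemma leading_exponents_product_subalgebra:
  fixes S T :: "'v sxpoly set"
  assumes order: "monomial_order ord"
    and S: "subalgebra S" "s_var \<in> S" "S \<subseteq> vars_in V"
    and T: "subalgebra T" "s_var \<in> T" "T \<subseteq> vars_in W"
    and disjoint: "V \<inter> W = {}"
    and f: "f \<in> cpoly_span {p * q | p q. p \<in> S \<and> q \<in> T}" "f \<noteq> 0"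
  obtains x y where "x \<in> leading_exponents ord S" and "y \<in> leading_exponents ord T"
    and "leading_exponent ord f = x + y"
proof -
  interpret monomial_ordering ord
    using order by unfold_locales
  obtain A g where g': "\<forall>a\<in>A. g a \<in> S \<and> g a \<noteq> 0 \<and> snd (leading_exponent ord (g a)) = a"
    and gS: "S \<subseteq> cpoly_span {s_var ^ j * g a | j a. a \<in> A}"
    by (rule subalgebra_s_adapted_basis[OF order S(1,2)])
  obtain B h where h': "\<forall>b\<in>B. h b \<in> T \<and> h b \<noteq> 0 \<and> snd (leading_exponent ord (h b)) = b"
    and hT: "T \<subseteq> cpoly_span {s_var ^ j * h b | j b. b \<in> B}"
    by (rule subalgebra_s_adapted_basis[OF order T(1,2)])
  have g: "g a \<in> S" "g a \<noteq> 0" "snd (leading_exponent ord (g a)) = a" if "a \<in> A" for a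
    using g' that by simp_all
  have h: "h b \<in> T" "h b \<noteq> 0" "snd (leading_exponent ord (h b)) = b" if "b \<in> B" for b
    using h' that by simp_all
  define P where "P = {s_var ^ n * (g a * h b) | n a b. a \<in> A \<and> b \<in> B}"
  have "{p * q | p q. p \<in> S \<and> q \<in> T} \<subseteq> cpoly_span P"
  proof -
    let ?X = "{s_var ^ j * g a | j a. a \<in> A}" and ?Y = "{s_var ^ j * h b | j b. b \<in> B}"
    have "x * y \<in> P" if x: "x \<in> ?X" and y: "y \<in> ?Y" for x y
    proof -
      obtain i a where "a \<in> A" "x = s_var ^ i * g a" using x by blast
      moreover obtain j b where "b \<in> B" "y = s_var ^ j * h b" using y by blast
      moreover have "s_var ^ i * g a * (s_var ^ j * h b) = s_var ^ (i + j) * (g a * h b)"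
        by (simp add: power_add ac_simps)
      ultimately show ?thesis unfolding P_def by blast
    qed
    hence "cpoly_span {x * y | x y. x \<in> ?X \<and> y \<in> ?Y} \<subseteq> cpoly_span P"
      by (intro cpoly.span_mono) blast
    moreover have "p * q \<in> cpoly_span {x * y | x y. x \<in> ?X \<and> y \<in> ?Y}" if "p \<in> S" "q \<in> T" for p q
      using subsetD[OF gS that(1)] subsetD[OF hT that(2)] by (rule mult_in_span_of_products)
    ultimately show ?thesis
      by blast
  qed
  hence "cpoly_span {p * q | p q. p \<in> S \<and> q \<in> T} \<subseteq> cpoly_span P"
    by (rule cpoly.span_minimal) (rule cpoly.subspace_span)
  hence fP: "f \<in> cpoly_span P"
    using f(1) by (rule subsetD)
  have le: "leading_exponent ord (s_var ^ n * (g a * h b)) =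
      (n, 0) + (leading_exponent ord (g a) + leading_exponent ord (h b))"
    if "a \<in> A" "b \<in> B" for n a b
  proof -
    have "leading_exponent ord (s_var ^ n) = (n, 0)"
      by (simp add: s_var_power leading_exponent_single)
    thus ?thesis
      using g h that by (simp add: leading_exponent_mult mult_nonzero s_var_power_nonzero)
  qed
  have "0 \<notin> P"
  proof
    assume "0 \<in> P"
    then obtain n a b where "a \<in> A" "b \<in> B" and zero: "0 = s_var ^ n * (g a * h b)"
      unfolding P_def by blast
    hence "s_var ^ n * (g a * h b) \<noteq> 0"
      using g(2) h(2) by (intro mult_nonzero s_var_power_nonzero)
    thus False
      using zero by simp
  qed
  moreover have "inj_on (leading_exponent ord) P"
  proof (rule inj_onI)
    fix p q assume "p \<in> P" "q \<in> P" and eq: "leading_exponent ord p = leading_exponent ord q"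
    then obtain m a b n a' b' where p: "p = s_var ^ m * (g a * h b)" and ab: "a \<in> A" "b \<in> B"
      and q: "q = s_var ^ n * (g a' * h b')" and ab': "a' \<in> A" "b' \<in> B"
      unfolding P_def by blast
    have A: "Poly_Mapping.keys c \<subseteq> V" if "c \<in> A" for c
      using leading_exponent_in_keys[OF g(2)[OF that]] g(1,3)[OF that] S(3)
      unfolding vars_in_def by fastforce
    have B: "Poly_Mapping.keys c \<subseteq> W" if "c \<in> B" for c
      using leading_exponent_in_keys[OF h(2)[OF that]] h(1,3)[OF that] T(3)
      unfolding vars_in_def by fastforce
    have eq': "(m, 0) + (leading_exponent ord (g a) + leading_exponent ord (h b)) =
      (n, 0) + (leading_exponent ord (g a') + leading_exponent ord (h b'))"
      using eq ab ab' unfolding p q by (simp add: le)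
    have sum: "a + b = a' + b'"
      using arg_cong[OF eq', of snd] g(3) h(3) ab ab' by simp
    have "a = a'" "b = b'"
      by (rule add_disjoint_keys_cancel[OF A[OF ab(1)] A[OF ab'(1)] B[OF ab(2)] B[OF ab'(2)]
          disjoint sum])+
    moreover from this have "m = n"
      using arg_cong[OF eq', of fst] by simp
    ultimately show "p = q"
      by (simp add: p q)
  qed
  ultimately have "leading_exponent ord f \<in> leading_exponents ord P"
    using fP f(2) by (rule leading_exponent_in_span)
  then obtain n a b where ab: "a \<in> A" "b \<in> B"
    and "leading_exponent ord f = leading_exponent ord (s_var ^ n * (g a * h b))"
    unfolding leading_exponents_def P_def by blast
  moreover have "leading_exponent ord (s_var ^ n * g a) = (n, 0) + leading_exponent ord (g a)"
    using g(2)[OF ab(1)]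
    by (simp add: leading_exponent_mult s_var_power_nonzero) (simp add: s_var_power leading_exponent_single)
  ultimately have eq: "leading_exponent ord f =
      leading_exponent ord (s_var ^ n * g a) + leading_exponent ord (h b)"
    using le by (simp add: add.assoc)
  have "s_var ^ n * g a \<in> S"
    using S(1) subalgebra_power[OF S(1,2)] g(1)[OF ab(1)] by (simp add: subalgebra_def)
  hence "leading_exponent ord (s_var ^ n * g a) \<in> leading_exponents ord S"
    using g(2)[OF ab(1)] by (intro leading_exponentsI[OF _ mult_nonzero]) (simp_all add: s_var_power_nonzero)
  moreover have "leading_exponent ord (h b) \<in> leading_exponents ord T"
    using h ab by (auto intro: leading_exponentsI)
  ultimately show ?thesis
    using eq by (rule that)
qed

section \<open>Joining two sets of polynomials in separate variables\<close>

lemma embed_poly_const: "embed_poly (const_poly c) = const_poly c"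
  by (cases "c = 0") (auto simp: embed_poly_def const_poly_def zero_prod_def)

text \<open>A nonzero constant homogenizes to a multiple of \<open>s\<close>.\<close>

lemma s_var_in_generated_subalgebra:
  assumes "c \<noteq> 0" and "const_poly c \<in> \<B>"
  shows "s_var \<in> generated_subalgebra (homogenized \<B>)"
proof -
  have "s_var * const_poly c \<in> homogenized \<B>"
    using assms(2) unfolding homogenized_def by (auto simp flip: embed_poly_const)
  hence "scale_poly c s_var \<in> generated_subalgebra (homogenized \<B>)"
    using generated_subalgebra_superset by (auto simp: scale_poly_def mult.commute)
  hence "scale_poly (inverse c) (scale_poly c s_var) \<in> generated_subalgebra (homogenized \<B>)"
    using subalgebra_generated cpoly.subspace_scale unfolding subalgebra_def by blast
  thus ?thesis
    using assms(1) by simp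
qed

lemma generated_subalgebra_homogenized_vars_in:
  "generated_subalgebra (homogenized \<B>) \<subseteq> vars_in (\<Union>p\<in>\<B>. occurring_vars p)"
proof (rule generated_subalgebra_minimal[OF _ subalgebra_vars_in])
  let ?V = "\<Union>p\<in>\<B>. occurring_vars p"
  have "s_var * embed_poly h \<in> vars_in ?V" if "h \<in> \<B>" for h
  proof -
    have "embed_poly h \<in> vars_in ?V"
      unfolding embed_poly_def
    proof (rule cpoly.subspace_sum)
      show "cpoly_subspace (vars_in ?V)"
        using subalgebra_vars_in by (auto simp: subalgebra_def)
    qed (use that in \<open>auto simp: vars_in_def occurring_vars_def split: if_splits\<close>)
    moreover have "s_var \<in> vars_in ?V"
      by (auto simp: vars_in_def s_var_def)
    ultimately show ?thesis
      using subalgebra_vars_in unfolding subalgebra_def by blast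
  qed
  thus "homogenized \<B> \<subseteq> vars_in ?V"
    by (auto simp: homogenized_def)
qed

text \<open>A leading exponent of the joint algebra splits into one of each of the two algebras, and each
  part is a sum of leading exponents of generators by assumption.\<close>

lemma khovanskii_basis_homogenized_Un:
  fixes \<B> \<C> :: "'v xpoly set"
  assumes gt: "monomial_order gt"
    and disjoint: "\<And>p q. p \<in> \<B> \<Longrightarrow> q \<in> \<C> \<Longrightarrow> occurring_vars p \<inter> occurring_vars q = {}"
    and B: "b \<noteq> 0" "const_poly b \<in> \<B>"
      "khovanskii_basis (extend_order gt) (homogenized \<B>) (generated_subalgebra (homogenized \<B>))"
    and C: "c \<noteq> 0" "const_poly c \<in> \<C>"
      "khovanskii_basis (extend_order gt) (homogenized \<C>) (generated_subalgebra (homogenized \<C>))"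
  shows "khovanskii_basis (extend_order gt) (homogenized (\<B> \<union> \<C>))
    (generated_subalgebra (homogenized (\<B> \<union> \<C>)))"
proof -
  let ?S = "generated_subalgebra (homogenized \<B>)"
  let ?T = "generated_subalgebra (homogenized \<C>)"
  let ?ST = "{p * q | p q. p \<in> ?S \<and> q \<in> ?T}"
  let ?LE = "leading_exponents (extend_order gt)"
  have order: "monomial_order (extend_order gt)"
    using gt by (rule monomial_order_extend)
  interpret monomial_ordering "extend_order gt"
    using order by unfold_locales
  note iff = khovanskii_basis_iff[OF generated_subalgebra_superset subalgebra_generated]
  have Un: "homogenized (\<B> \<union> \<C>) = homogenized \<B> \<union> homogenized \<C>"
    by (auto simp: homogenized_def)
  have one: "1 \<in> ?S" "1 \<in> ?T"
    using subalgebra_generated unfolding subalgebra_def by blast+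
  have "?S \<subseteq> ?ST"
    using one by (metis (mono_tags, lifting) mem_Collect_eq mult.right_neutral subsetI)
  moreover have "?T \<subseteq> ?ST"
    using one by (metis (mono_tags, lifting) mem_Collect_eq mult.left_neutral subsetI)
  ultimately have "homogenized (\<B> \<union> \<C>) \<subseteq> cpoly_span ?ST"
    unfolding Un using generated_subalgebra_superset cpoly.span_superset by blast
  hence gen: "generated_subalgebra (homogenized (\<B> \<union> \<C>)) \<subseteq> cpoly_span ?ST"
    by (rule generated_subalgebra_minimal)
      (intro subalgebra_span_products subalgebra_generated)
  have disjoint': "(\<Union>p\<in>\<B>. occurring_vars p) \<inter> (\<Union>q\<in>\<C>. occurring_vars q) = {}"
    using disjoint by blast
  have mono: "monoid_closure (?LE (homogenized \<B>)) \<subseteq> monoid_closure (?LE (homogenized (\<B> \<union> \<C>)))"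
    "monoid_closure (?LE (homogenized \<C>)) \<subseteq> monoid_closure (?LE (homogenized (\<B> \<union> \<C>)))"
    by (intro monoid_closure_mono leading_exponents_mono; simp add: Un)+
  have "leading_exponent (extend_order gt) f \<in> monoid_closure (?LE (homogenized (\<B> \<union> \<C>)))"
    if f: "f \<in> generated_subalgebra (homogenized (\<B> \<union> \<C>))" "f \<noteq> 0" for f
  proof -
    obtain x y where "x \<in> ?LE ?S" "y \<in> ?LE ?T" "leading_exponent (extend_order gt) f = x + y"
      using leading_exponents_product_subalgebra[OF order
          subalgebra_generated s_var_in_generated_subalgebra[OF B(1,2)]
          generated_subalgebra_homogenized_vars_in
          subalgebra_generated s_var_in_generated_subalgebra[OF C(1,2)]
          generated_subalgebra_homogenized_vars_in disjoint' _ f(2)] gen f(1) by blast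
    thus ?thesis
      using B(3) C(3) mono unfolding iff by (auto intro!: monoid_closure_add)
  qed
  thus ?thesis
    unfolding iff by (auto simp: leading_exponents_def)
qed

section \<open>Separate variables preserve Khovanskii bases\<close>

theorem theorem3p8:
  fixes f :: "nat \<Rightarrow> 'v::finite xpoly"
    and \<A> :: "'v xpoly set"
    and \<B> :: "nat \<Rightarrow> 'v xpoly set"
    and d :: nat
    and gt :: "('v \<Rightarrow>\<^sub>0 nat) \<Rightarrow> ('v \<Rightarrow>\<^sub>0 nat) \<Rightarrow> bool"
  assumes "finite \<A>"
    and "\<exists>c. c \<noteq> 0 \<and> const_poly c \<in> \<A>"
    and "\<forall>j\<in>{1..CARD('v)}. f j \<in> cpoly_span \<A>"
    and "\<A> = (\<Union>i\<in>{1..d}. \<B> i)"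
    and "\<forall>i\<in>{1..d}. \<forall>j\<in>{1..d}. i \<noteq> j \<longrightarrow>
           (\<forall>p\<in>\<B> i. \<forall>q\<in>\<B> j. occurring_vars p \<inter> occurring_vars q = {})"
    and "\<forall>i\<in>{1..d}. \<exists>c. c \<noteq> 0 \<and> const_poly c \<in> \<B> i"
    and "monomial_order gt"
    and "\<forall>i\<in>{1..d}.
           khovanskii_basis (extend_order gt) (homogenized (\<B> i))
             (generated_subalgebra (homogenized (\<B> i)))"
  shows "khovanskii_basis (extend_order gt) (homogenized \<A>)
           (generated_subalgebra (homogenized \<A>))"
proof -
  have "khovanskii_basis (extend_order gt) (homogenized (\<Union>i\<in>I. \<B> i))
      (generated_subalgebra (homogenized (\<Union>i\<in>I. \<B> i)))"
    if "finite I" "I \<noteq> {}" "I \<subseteq> {1..d}" for I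
    using that
  proof (induction rule: finite_ne_induct)
    case (singleton i)
    thus ?case using assms(8) by simp
  next
    case (insert i I)
    obtain b where b: "b \<noteq> 0" "const_poly b \<in> \<B> i"
      using assms(6) insert.prems by blast
    obtain k where "k \<in> I"
      using insert.hyps by blast
    then obtain c where c: "c \<noteq> 0" "const_poly c \<in> (\<Union>i\<in>I. \<B> i)"
      using assms(6) insert.prems by blast
    have disjoint: "occurring_vars p \<inter> occurring_vars q = {}"
      if "p \<in> \<B> i" "q \<in> (\<Union>i\<in>I. \<B> i)" for p q
    proof -
      obtain j where j: "j \<in> I" "q \<in> \<B> j"
        using \<open>q \<in> (\<Union>i\<in>I. \<B> i)\<close> by blast
      hence "i \<noteq> j" "i \<in> {1..d}" "j \<in> {1..d}"
        using insert.hyps insert.prems by auto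
      thus ?thesis
        using assms(5) j \<open>p \<in> \<B> i\<close> by simp
    qed
    have "khovanskii_basis (extend_order gt) (homogenized (\<B> i \<union> (\<Union>i\<in>I. \<B> i)))
        (generated_subalgebra (homogenized (\<B> i \<union> (\<Union>i\<in>I. \<B> i))))"
    proof (rule khovanskii_basis_homogenized_Un[OF assms(7) disjoint b _ c])
      show "khovanskii_basis (extend_order gt) (homogenized (\<B> i))
          (generated_subalgebra (homogenized (\<B> i)))"
        using assms(8) insert.prems by blast
      show "khovanskii_basis (extend_order gt) (homogenized (\<Union>i\<in>I. \<B> i))
          (generated_subalgebra (homogenized (\<Union>i\<in>I. \<B> i)))"
        using insert.IH insert.prems by blast
    qed
    thus ?case by simp
  qed
  (* The induction starts from one set: the empty union does not contain a constant. *)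
  moreover have "{1..d} \<noteq> {}"
    using assms(2,4) by auto
  ultimately show ?thesis
    unfolding assms(4) by blast
qed

end
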